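(* Let $r\ge0$, let $F_i:\mathbb{R}\times\mathbb{R}^n\to\mathbb{R}^n$ ($0\le i\le m$) be continuous mappings which are locally Lipschitz in the space variable $x$ uniformly with respect to $t$ in bounded intervals, and let $r_i:\mathbb{R}\to[0,r]$ ($1\le i\le m$) be measurable functions. Suppose there are constants $p>q\ge1$, $\alpha_i>0$ ($0\le i\le m$) and nonnegative measurable functions $\beta_i$ ($0\le i\le m$) on $\mathbb{R}$ such that for all $x\in\mathbb{R}^n$, $t\in\mathbb{R}$, $$(F_0(t,x),x)\le-\alpha_0|x|^{p+1}+\beta_0(t),\qquad |F_i(t,x)|\le\alpha_i|x|^q+\beta_i(t)\quad(1\le i\le m).$$ Suppose that there exist $M,N>0$ such that $$\sum_{i=0}^m\int_s^t\beta_i(\mu)\,d\mu\le M(t-s)+N,\qquad -\infty<s<t<\infty .$$ Then each solution $x(t;\tau,\phi)$ of the system $$\dot x=F_0(t,x)+\sum_{i=1}^mF_i\big(t,x(t-r_i(t))\big),\qquad x=x(t)\in\mathbb{R}^n,$$ is globally defined for $t\ge\tau$. Furthermore, there exist $C,\lambda,\rho>0$ independent of $\tau\in\mathbb{R}$ such that $$|x(t;\tau,\phi)|\le C\|\phi\|e^{-\lambda(t-\tau)}+\rho,\qquad\forall\,t\ge\tau,\ (\tau,\phi)\in\mathbb{R}\times\mathcal{C}.$$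
   Context: $\mathcal{C}=C([-r,0],\mathbb{R}^n)$ with the sup-norm $\|\cdot\|$; $(\cdot,\cdot)$ and $|\cdot|$ are the Euclidean inner product and norm on $\mathbb{R}^n$. For $(\tau,\phi)\in\mathbb{R}\times\mathcal{C}$, $x(t;\tau,\phi)$ denotes the unique solution of the system with $x(\tau+s)=\phi(s)$, $s\in[-r,0]$, on its maximal existence interval $[\tau-r,T_\phi)$. Since the $r_i$ are only measurable, a solution is a continuous function satisfying the integrated form of the equation for $t\ge\tau$. *)

theory Defs
  imports "HOL-Analysis.Analysis"
begin

text \<open>
  A history in \<open>C([-r,0], \<real>\<^sup>n)\<close> is a total function that is continuous on \<open>{-r..0}\<close>; its values
  elsewhere play no role. Measurability and integrals are in the sense of Lebesgue.
\<close>

definition hist_norm :: "real \<Rightarrow> (real \<Rightarrow> real ^ 'n) \<Rightarrow> real" where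
  "hist_norm r \<phi> = (SUP s\<in>{-r..0}. norm (\<phi> s))"

definition loc_lipschitz_in_space :: "(real \<Rightarrow> real ^ 'n \<Rightarrow> real ^ 'n) \<Rightarrow> bool" where
  "loc_lipschitz_in_space G \<longleftrightarrow>
     (\<forall>a b x0. \<exists>\<epsilon>>0. \<exists>L. \<forall>t\<in>{a..b}. L-lipschitz_on (ball x0 \<epsilon>) (G t))"

definition delay_rhs ::
  "nat \<Rightarrow> (nat \<Rightarrow> real \<Rightarrow> real ^ 'n \<Rightarrow> real ^ 'n) \<Rightarrow> (nat \<Rightarrow> real \<Rightarrow> real)
    \<Rightarrow> (real \<Rightarrow> real ^ 'n) \<Rightarrow> real \<Rightarrow> real ^ 'n" where
  "delay_rhs m F \<delta> x t = F 0 t (x t) + (\<Sum>i=1..m. F i t (x (t - \<delta> i t)))"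

text \<open>
  \<open>x\<close> is a solution on \<open>[\<tau>-r, T)\<close> with \<open>T \<in> (\<tau>, \<infinity>]\<close>. As the delays \<open>\<delta> i\<close> are only measurable, the
  equation is required in integrated form. Values of \<open>x\<close> outside \<open>[\<tau>-r, T)\<close> are irrelevant
  when the delays take values in \<open>{0..r}\<close>.
\<close>

definition delay_solution ::
  "real \<Rightarrow> nat \<Rightarrow> (nat \<Rightarrow> real \<Rightarrow> real ^ 'n \<Rightarrow> real ^ 'n) \<Rightarrow> (nat \<Rightarrow> real \<Rightarrow> real)
    \<Rightarrow> real \<Rightarrow> (real \<Rightarrow> real ^ 'n) \<Rightarrow> ereal \<Rightarrow> (real \<Rightarrow> real ^ 'n) \<Rightarrow> bool" where
  "delay_solution r m F \<delta> \<tau> \<phi> T x \<longleftrightarrow>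
     ereal \<tau> < T \<and>
     (\<forall>s\<in>{-r..0}. x (\<tau> + s) = \<phi> s) \<and>
     continuous_on {t. \<tau> - r \<le> t \<and> ereal t < T} x \<and>
     (\<forall>t. \<tau> \<le> t \<and> ereal t < T \<longrightarrow>
        set_integrable lebesgue {\<tau>..t} (delay_rhs m F \<delta> x) \<and>
        x t = \<phi> 0 + (LINT s:{\<tau>..t}|lebesgue. delay_rhs m F \<delta> x s))"

definition maximal_delay_solution ::
  "real \<Rightarrow> nat \<Rightarrow> (nat \<Rightarrow> real \<Rightarrow> real ^ 'n \<Rightarrow> real ^ 'n) \<Rightarrow> (nat \<Rightarrow> real \<Rightarrow> real)
    \<Rightarrow> real \<Rightarrow> (real \<Rightarrow> real ^ 'n) \<Rightarrow> ereal \<Rightarrow> (real \<Rightarrow> real ^ 'n) \<Rightarrow> bool" where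
  "maximal_delay_solution r m F \<delta> \<tau> \<phi> T x \<longleftrightarrow>
     delay_solution r m F \<delta> \<tau> \<phi> T x \<and>
     (\<forall>T' y. delay_solution r m F \<delta> \<tau> \<phi> T' y \<and> T \<le> T' \<and>
        (\<forall>t. \<tau> - r \<le> t \<and> ereal t < T \<longrightarrow> y t = x t) \<longrightarrow> T' = T)"

end

theory Submission
  imports Defs
begin

text \<open>
  Along a solution \<open>norm x\<close> satisfies, where it is at least \<open>1\<close>, the differential inequality with
  right hand side \<open>- \<alpha> 0 * norm x powr p + (\<Sum>i. \<alpha> i * norm (x (t - \<delta> i t)) powr q) + (\<Sum>i. \<beta> i t)\<close>.
  Let \<open>K\<close> be large and bound the history at time \<open>s\<close>. As \<open>p > q\<close>, the first two terms are at most
  \<open>- K - M\<close> as long as the present state is at least \<open>K / 2\<close> and the delayed ones are at most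
  \<open>K + N + 1\<close>; a rise over an interval on which this holds is therefore at most \<open>N\<close>. Hence the solution
  never reaches \<open>K + N + 1\<close> after \<open>s\<close>, falls to \<open>K / 2\<close> within one time unit, and stays below
  \<open>K / 2 + N\<close> from time \<open>s + 1\<close> on. Iterating with time step \<open>r + 1\<close> gives the exponential estimate.
  Global existence follows by truncating \<open>F\<close> outside a ball that is larger than this a priori bound: the
  truncated system is globally Lipschitz and its solutions never leave the ball.
\<close>

section \<open>Level crossings of continuous functions and growth of the norm along integral
  curves\<close>

text \<open>The level set is compact and, by the intermediate value theorem, nonempty; its least
  point is the time sought, since an earlier value of at least \<open>c\<close> would force a still
  earlier crossing.\<close>

lemma first_time_eq:
  fixes f :: "real \<Rightarrow> real"
  assumes "a \<le> b" "continuous_on {a..b} f" "f a < c" "c \<le> f b"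
  obtains t where "a < t" "t \<le> b" "f t = c" "\<And>s. a \<le> s \<Longrightarrow> s < t \<Longrightarrow> f s < c"
proof -
  let ?S = "{t \<in> {a..b}. f t = c}"
  have "closed ?S"
    using continuous_closed_preimage_constant[of "{a..b}" f c] assms(2) by simp
  then have "compact ?S"
    by (metis (no_types, lifting) compact_Icc compact_Int_closed inf.absorb_iff2 mem_Collect_eq subsetI)
  moreover have "?S \<noteq> {}"
    using IVT'[of f a c b] assms by force
  ultimately obtain t where t: "t \<in> ?S" "\<And>u. u \<in> ?S \<Longrightarrow> t \<le> u"
    using compact_attains_inf by (metis (no_types, lifting))
  show ?thesis
  proof
    show "a < t" using t(1) assms(3) by (cases "t = a") auto
    show "t \<le> b" "f t = c" using t(1) by auto
    fix s assume s: "a \<le> s" "s < t"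
    show "f s < c"
    proof (rule ccontr)
      assume "\<not> f s < c"
      moreover have "continuous_on {a..s} f"
        by (rule continuous_on_subset[OF assms(2)]) (use s t(1) in auto)
      ultimately obtain u where "a \<le> u" "u \<le> s" "f u = c"
        using IVT'[of f a c s] assms s by force
      then show False using t(2)[of u] t(1) s by force
    qed
  qed
qed

text \<open>Time reversal: the first crossing of \<open>- f (- s)\<close> yields the last crossing
  of \<open>f\<close>.\<close>

lemma last_time_eq:
  fixes f :: "real \<Rightarrow> real"
  assumes "a \<le> b" "continuous_on {a..b} f" "f a \<le> c" "c < f b"
  obtains t where "a \<le> t" "t < b" "f t = c" "\<And>s. t < s \<Longrightarrow> s \<le> b \<Longrightarrow> c < f s"
proof -
  have "continuous_on {-b..-a} (\<lambda>s. - f (- s))"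
    by (intro continuous_intros continuous_on_compose2[OF assms(2)]) auto
  from first_time_eq[OF _ this, of "-c"] assms
  obtain t where t: "-b < t" "t \<le> -a" "- f (- t) = - c"
      "\<And>s. -b \<le> s \<Longrightarrow> s < t \<Longrightarrow> - f (- s) < - c"
    by (metis minus_le_iff minus_minus neg_le_iff_le neg_less_iff_less)
  show ?thesis
  proof
    show "a \<le> -t" "-t < b" "f (-t) = c" using t by auto
    fix s assume "-t < s" "s \<le> b"
    then show "c < f s" using t(4)[of "-s"] by auto
  qed
qed

text \<open>
  A substitute for differentiating \<open>norm x\<close> almost everywhere: by convexity of the norm,
  \<open>norm (x t) - norm (x s) \<le> (x t - x s) \<bullet> sgn (x t)\<close>, and on short intervals \<open>sgn (x t)\<close> is
  uniformly close to \<open>sgn (x \<sigma>)\<close>.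
\<close>

lemma norm_increment_le_integral_sgn:
  fixes x g :: "real \<Rightarrow> 'a :: euclidean_space"
  assumes "a \<le> b"
    and cont: "continuous_on {a..b} x"
    and g: "g absolutely_integrable_on {a..b}"
    and x: "\<And>s t. a \<le> s \<Longrightarrow> s \<le> t \<Longrightarrow> t \<le> b \<Longrightarrow> x t = x s + integral {s..t} g"
    and nz: "\<And>t. a \<le> t \<Longrightarrow> t \<le> b \<Longrightarrow> x t \<noteq> 0"
  shows "(\<lambda>t. g t \<bullet> sgn (x t)) absolutely_integrable_on {a..b}"
    and "norm (x b) - norm (x a) \<le> integral {a..b} (\<lambda>t. g t \<bullet> sgn (x t))"
proof -
  have scont: "continuous_on {a..b} (\<lambda>t. sgn (x t))"
    unfolding sgn_div_norm by (intro continuous_intros cont) (use nz in auto)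
  have "(\<lambda>t. sgn (x t) \<bullet> g t) absolutely_integrable_on {a..b}"
    by (rule absolutely_integrable_bounded_measurable_product[OF _ _ _ _ g])
      (auto simp: bilinear_def inner_simps intro!: linearI continuous_imp_measurable_on_sets_lebesgue scont compact_imp_bounded compact_continuous_image)
  then show ai: "(\<lambda>t. g t \<bullet> sgn (x t)) absolutely_integrable_on {a..b}"
    by (simp add: inner_commute)
  define h where "h = (\<lambda>t. g t \<bullet> sgn (x t))"
  have gi: "g integrable_on {s..t}" and ngi: "(\<lambda>t. norm (g t)) integrable_on {s..t}"
    and hi: "h integrable_on {s..t}" if "a \<le> s" "t \<le> b" for s t
  proof -
    have "{s..t} \<subseteq> {a..b}" using that by auto
    then have "g absolutely_integrable_on {s..t}" "h absolutely_integrable_on {s..t}"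
      using g ai unfolding h_def by (meson absolutely_integrable_on_subinterval)+
    then show "g integrable_on {s..t}" "(\<lambda>t. norm (g t)) integrable_on {s..t}" "h integrable_on {s..t}"
      by (auto simp: absolutely_integrable_on_def)
  qed
  let ?J = "integral {a..b} (\<lambda>t. norm (g t))"
  have "norm (x b) - norm (x a) \<le> integral {a..b} h + e * ?J" if "e > 0" for e
  proof -
    have "uniformly_continuous_on {a..b} (\<lambda>t. sgn (x t))"
      using scont by (simp add: compact_uniformly_continuous)
    then obtain d where "d > 0"
      and d: "\<And>s t. s \<in> {a..b} \<Longrightarrow> t \<in> {a..b} \<Longrightarrow> dist s t < d \<Longrightarrow> dist (sgn (x s)) (sgn (x t)) < e"
      unfolding uniformly_continuous_on_def using \<open>e > 0\<close> by (metis dist_commute)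
    have step: "norm (x t) - norm (x s) \<le> integral {s..t} h + e * integral {s..t} (\<lambda>t. norm (g t))"
      if st: "a \<le> s" "s \<le> t" "t \<le> b" "t - s < d" for s t
    proof -
      have "norm (x t) = x t \<bullet> sgn (x t)"
        using nz[of t] st by (simp add: sgn_div_norm dot_square_norm power2_eq_square)
      moreover have "x s \<bullet> sgn (x t) \<le> norm (x s)"
        using norm_cauchy_schwarz[of "x s" "sgn (x t)"] by (simp add: norm_sgn split: if_splits)
      ultimately have "norm (x t) - norm (x s) \<le> (x t - x s) \<bullet> sgn (x t)"
        by (simp add: inner_diff_left)
      also have "\<dots> = integral {s..t} g \<bullet> sgn (x t)"
        using x[of s t] st by simp
      also have "\<dots> = integral {s..t} (\<lambda>u. g u \<bullet> sgn (x t))"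
        using integral_component_eq gi[of s t] st
        by (metis (no_types) bounded_linear_inner_left integral_linear[unfolded o_def])
      also have "\<dots> \<le> integral {s..t} (\<lambda>u. h u + e * norm (g u))"
      proof (rule integral_le)
        show "(\<lambda>u. g u \<bullet> sgn (x t)) integrable_on {s..t}"
          using integrable_linear[OF gi[of s t] bounded_linear_inner_left] st by (simp add: o_def)
        show "(\<lambda>u. h u + e * norm (g u)) integrable_on {s..t}"
          using hi[of s t] ngi[of s t] st by (intro integrable_add integrable_on_mult_right) auto
        fix u assume u: "u \<in> {s..t}"
        have "g u \<bullet> sgn (x t) - h u = g u \<bullet> (sgn (x t) - sgn (x u))"
          by (simp add: h_def inner_diff_right)
        also have "\<dots> \<le> norm (g u) * norm (sgn (x t) - sgn (x u))"
          by (rule norm_cauchy_schwarz)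
        also have "\<dots> \<le> norm (g u) * e"
          by (rule mult_left_mono)
            (use d[of t u] st u in \<open>auto simp: dist_real_def dist_norm\<close>)
        finally show "g u \<bullet> sgn (x t) \<le> h u + e * norm (g u)" by (simp add: mult.commute)
      qed
      also have "\<dots> = integral {s..t} h + e * integral {s..t} (\<lambda>t. norm (g t))"
        using hi[of s t] ngi[of s t] st by (subst integral_add) (auto intro!: integrable_on_mult_right)
      finally show ?thesis .
    qed
    \<comment> \<open>Short steps are chained by peeling off pieces of length at most
      \<open>d/2\<close> from the right end; halving \<open>d\<close> leaves the strict inequality
      that \<open>step\<close> asks for.\<close>
    have "norm (x t) - norm (x s) \<le> integral {s..t} h + e * integral {s..t} (\<lambda>t. norm (g t))"
      if "a \<le> s" "s \<le> t" "t \<le> b" "t - s \<le> real n * (d/2)" for n s t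
      using that
    proof (induction n arbitrary: t)
      case 0
      then show ?case using step[of s t] \<open>d > 0\<close> by simp
    next
      case (Suc n)
      define c where "c = max s (t - d/2)"
      have c: "s \<le> c" "c \<le> t" "t - c < d" "c - s \<le> real n * (d/2)"
        using Suc.prems \<open>d > 0\<close> by (auto simp: c_def field_simps max_def)
      have "norm (x c) - norm (x s) \<le> integral {s..c} h + e * integral {s..c} (\<lambda>t. norm (g t))"
        using Suc.IH[of c] Suc.prems c by auto
      moreover have "norm (x t) - norm (x c) \<le> integral {c..t} h + e * integral {c..t} (\<lambda>t. norm (g t))"
        using step[of c t] Suc.prems c by auto
      moreover have "integral {s..c} h + integral {c..t} h = integral {s..t} h"
        using Suc.prems c hi[of s t] by (intro Henstock_Kurzweil_Integration.integral_combine) auto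
      moreover have "integral {s..c} (\<lambda>t. norm (g t)) + integral {c..t} (\<lambda>t. norm (g t))
          = integral {s..t} (\<lambda>t. norm (g t))"
        using Suc.prems c ngi[of s t] by (intro Henstock_Kurzweil_Integration.integral_combine) auto
      ultimately show ?case by (smt (verit) distrib_left)
    qed
    moreover obtain n where "b - a \<le> real n * (d/2)"
      using reals_Archimedean3[of "d/2"] \<open>d > 0\<close> by (metis half_gt_zero less_eq_real_def)
    ultimately show ?thesis using \<open>a \<le> b\<close> by blast
  qed
  note eps = this
  have "?J \<ge> 0" using ngi[of a b] by (intro integral_nonneg) auto
  show "norm (x b) - norm (x a) \<le> integral {a..b} (\<lambda>t. g t \<bullet> sgn (x t))"
  proof (rule field_le_epsilon)
    fix e :: real assume "e > 0"
    \<comment> \<open>The \<open>+ 1\<close> keeps the divisor positive when \<open>?J\<close>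
      vanishes.\<close>
    then have "norm (x b) - norm (x a) \<le> integral {a..b} h + e / (?J + 1) * ?J"
      using \<open>?J \<ge> 0\<close> by (intro eps) auto
    also have "e / (?J + 1) * ?J \<le> e"
      using \<open>?J \<ge> 0\<close> \<open>e > 0\<close> by (simp add: field_simps)
    finally show "norm (x b) - norm (x a) \<le> integral {a..b} (\<lambda>t. g t \<bullet> sgn (x t)) + e"
      by (simp add: h_def)
  qed
qed

section \<open>Solutions on compact time intervals\<close>

text \<open>Solutions are restated with a real, included end point and the gauge integral; all
  estimates and the fixed point argument live on such compact intervals, and extended end points
  return only at the very end.\<close>

definition solves_upto ::
  "real \<Rightarrow> nat \<Rightarrow> (nat \<Rightarrow> real \<Rightarrow> real ^ 'n \<Rightarrow> real ^ 'n) \<Rightarrow> (nat \<Rightarrow> real \<Rightarrow> real)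
    \<Rightarrow> real \<Rightarrow> (real \<Rightarrow> real ^ 'n) \<Rightarrow> real \<Rightarrow> (real \<Rightarrow> real ^ 'n) \<Rightarrow> bool" where
  "solves_upto r m F \<delta> \<tau> \<phi> b x \<longleftrightarrow>
     (\<forall>s\<in>{-r..0}. x (\<tau> + s) = \<phi> s) \<and>
     continuous_on {\<tau> - r..b} x \<and>
     delay_rhs m F \<delta> x absolutely_integrable_on {\<tau>..b} \<and>
     (\<forall>t\<in>{\<tau>..b}. x t = \<phi> 0 + integral {\<tau>..t} (delay_rhs m F \<delta> x))"

lemma solves_upto_restrict:
  assumes "solves_upto r m F \<delta> \<tau> \<phi> b x" "c \<le> b"
  shows "solves_upto r m F \<delta> \<tau> \<phi> c x"
  using assms unfolding solves_upto_def
  by (auto elim!: continuous_on_subset intro: absolutely_integrable_on_subinterval)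

text \<open>As delays lie in \<open>{0..r}\<close>, the right hand side up to time \<open>b\<close>
  sees \<open>x\<close> only on \<open>{\<tau> - r..b}\<close>. Trajectory and vector field may
  change together, which serves both gluing and truncation.\<close>

lemma delay_rhs_cong:
  assumes "\<And>u. \<tau> - r \<le> u \<Longrightarrow> u \<le> b \<Longrightarrow> x u = y u"
    and "\<And>i u. i \<in> {1..m} \<Longrightarrow> \<delta> i u \<in> {0..r}"
    and "\<And>u. u \<in> {\<tau>..b} \<Longrightarrow> F 0 u (x u) = G 0 u (x u)"
    and "\<And>i u. i \<in> {1..m} \<Longrightarrow> u \<in> {\<tau>..b} \<Longrightarrow> F i u (x (u - \<delta> i u)) = G i u (x (u - \<delta> i u))"
    and t: "t \<in> {\<tau>..b}" and "r \<ge> 0"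
  shows "delay_rhs m F \<delta> x t = delay_rhs m G \<delta> y t"
proof -
  have "x (t - \<delta> i t) = y (t - \<delta> i t)" if "i \<in> {1..m}" for i
    using assms(2)[OF that, of t] t by (intro assms(1)) auto
  moreover have "x t = y t" using assms(1)[of t] t \<open>r \<ge> 0\<close> by auto
  ultimately show ?thesis
    using assms(3)[of t] assms(4)[of _ t] t \<open>r \<ge> 0\<close> unfolding delay_rhs_def
    by (intro arg_cong2[where f="(+)"] sum.cong) auto
qed

lemma solves_upto_cong:
  assumes x: "solves_upto r m F \<delta> \<tau> \<phi> b x"
    and eq: "\<And>u. \<tau> - r \<le> u \<Longrightarrow> u \<le> b \<Longrightarrow> x u = y u"
    and \<delta>: "\<And>i u. i \<in> {1..m} \<Longrightarrow> \<delta> i u \<in> {0..r}"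
    and FG: "\<And>i u v. i \<le> m \<Longrightarrow> u \<in> {\<tau>..b} \<Longrightarrow> v \<in> {\<tau> - r..b} \<Longrightarrow> F i u (x v) = G i u (x v)"
    and "r \<ge> 0" "\<tau> \<le> b"
  shows "solves_upto r m G \<delta> \<tau> \<phi> b y"
proof -
  have *: "delay_rhs m F \<delta> x t = delay_rhs m G \<delta> y t" if "t \<in> {\<tau>..b}" for t
  proof (rule delay_rhs_cong[OF eq \<delta> _ _ that \<open>r \<ge> 0\<close>])
    fix i u assume "i \<in> {1..m}" "u \<in> {\<tau>..b}"
    then show "F i u (x (u - \<delta> i u)) = G i u (x (u - \<delta> i u))"
      using \<delta>[of i u] by (intro FG) auto
  qed (use FG \<open>r \<ge> 0\<close> in auto)
  have "delay_rhs m G \<delta> y absolutely_integrable_on {\<tau>..b}"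
    using x * unfolding solves_upto_def
    by (metis (no_types, lifting) absolutely_integrable_spike_eq empty_iff negligible_empty Diff_empty)
  moreover have "integral {\<tau>..t} (delay_rhs m F \<delta> x) = integral {\<tau>..t} (delay_rhs m G \<delta> y)"
    if "t \<in> {\<tau>..b}" for t
    using that by (intro integral_cong *) auto
  moreover have "continuous_on {\<tau> - r..b} y"
    using x eq unfolding solves_upto_def by (metis (no_types, lifting) atLeastAtMost_iff continuous_on_cong)
  ultimately show ?thesis
    using x \<open>r \<ge> 0\<close> \<open>\<tau> \<le> b\<close> unfolding solves_upto_def by (simp flip: eq)
qed

text \<open>The half-open existence interval is exhausted by compact ones, and the equation at
  \<open>t\<close> involves only \<open>{\<tau>..t}\<close>; continuity is the one part that needs a
  local argument.\<close>

lemma delay_solution_iff_solves_upto: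
  assumes "r \<ge> 0"
  shows "delay_solution r m F \<delta> \<tau> \<phi> T x \<longleftrightarrow>
    ereal \<tau> < T \<and> (\<forall>b\<ge>\<tau>. ereal b < T \<longrightarrow> solves_upto r m F \<delta> \<tau> \<phi> b x)"
proof (intro iffI conjI allI impI)
  assume sol: "delay_solution r m F \<delta> \<tau> \<phi> T x"
  then show "ereal \<tau> < T" by (simp add: delay_solution_def)
  fix b assume b: "\<tau> \<le> b" "ereal b < T"
  have lt: "ereal t < T" if "t \<le> b" for t
    using b that by (meson ereal_less_eq(3) le_less_trans)
  have "continuous_on {\<tau> - r..b} x"
    by (rule continuous_on_subset[of "{t. \<tau> - r \<le> t \<and> ereal t < T}"])
      (use sol lt in \<open>auto simp: delay_solution_def\<close>)
  moreover have "x t = \<phi> 0 + integral {\<tau>..t} (delay_rhs m F \<delta> x)" if "t \<in> {\<tau>..b}" for t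
    using sol lt[of t] that set_lebesgue_integral_eq_integral(2)[of "{\<tau>..t}" "delay_rhs m F \<delta> x"]
    by (simp add: delay_solution_def)
  ultimately show "solves_upto r m F \<delta> \<tau> \<phi> b x"
    using sol b unfolding solves_upto_def delay_solution_def by auto
next
  assume *: "ereal \<tau> < T \<and> (\<forall>b\<ge>\<tau>. ereal b < T \<longrightarrow> solves_upto r m F \<delta> \<tau> \<phi> b x)"
  then have up: "\<And>b. \<tau> \<le> b \<Longrightarrow> ereal b < T \<Longrightarrow> solves_upto r m F \<delta> \<tau> \<phi> b x" by blast
  have "continuous_on {t. \<tau> - r \<le> t \<and> ereal t < T} x"
    unfolding continuous_on_eq_continuous_within
  proof
    \<comment> \<open>A real \<open>b\<close> strictly between \<open>t\<close> and \<open>T\<close>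
      makes the half-open domain and \<open>{\<tau> - r..b}\<close> agree near \<open>t\<close>. The
      maximum with \<tau> ensures \<open>b \<ge> \<tau>\<close> also when \<open>t\<close> lies in
      the history.\<close>
    fix t assume t: "t \<in> {t. \<tau> - r \<le> t \<and> ereal t < T}"
    then have "ereal (max t \<tau>) < T" using * by (auto simp: max_def)
    then obtain b where b: "ereal (max t \<tau>) < ereal b" "ereal b < T"
      using ereal_dense2[of "ereal (max t \<tau>)" T] by auto
    then have "continuous (at t within {\<tau> - r..b}) x"
      using up[of b] t unfolding solves_upto_def continuous_on_eq_continuous_within by auto
    moreover have "at t within {t. \<tau> - r \<le> t \<and> ereal t < T} = at t within {\<tau> - r..b}"
    proof (rule at_within_nhd[of _ "{..<b}"])
      have "ereal u < T" if "u \<le> b" for u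
        using b that by (meson ereal_less_eq(3) le_less_trans)
      then show "{t. \<tau> - r \<le> t \<and> ereal t < T} \<inter> {..<b} - {t} = {\<tau> - r..b} \<inter> {..<b} - {t}"
        by auto
    qed (use b in auto)
    ultimately show "continuous (at t within {t. \<tau> - r \<le> t \<and> ereal t < T}) x" by simp
  qed
  moreover have "x t = \<phi> 0 + (LINT s:{\<tau>..t}|lebesgue. delay_rhs m F \<delta> x s)
      \<and> set_integrable lebesgue {\<tau>..t} (delay_rhs m F \<delta> x)" if "\<tau> \<le> t" "ereal t < T" for t
    using up[OF that] that set_lebesgue_integral_eq_integral(2)[of "{\<tau>..t}" "delay_rhs m F \<delta> x"]
    by (auto simp: solves_upto_def)
  ultimately show "delay_solution r m F \<delta> \<tau> \<phi> T x"
    using * up[of \<tau>] unfolding delay_solution_def by (auto simp: solves_upto_def)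
qed

lemma norm_le_hist_norm:
  assumes "continuous_on {-r..0} \<phi>" "s \<in> {-r..0}"
  shows "norm (\<phi> s) \<le> hist_norm r \<phi>"
  unfolding hist_norm_def
proof (rule cSUP_upper[OF assms(2)])
  have "compact ((\<lambda>s. norm (\<phi> s)) ` {-r..0})"
    by (intro compact_continuous_image continuous_intros assms(1)) auto
  then show "bdd_above ((\<lambda>s. norm (\<phi> s)) ` {-r..0})"
    by (intro bounded_imp_bdd_above compact_imp_bounded)
qed

section \<open>A priori estimates for the dissipative system\<close>

locale dissipative_delay_system =
  fixes r p q M N :: real
    and m :: nat
    and F :: "nat \<Rightarrow> real \<Rightarrow> real ^ 'n \<Rightarrow> real ^ 'n"
    and \<delta> \<beta> :: "nat \<Rightarrow> real \<Rightarrow> real"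
    and \<alpha> :: "nat \<Rightarrow> real"
  assumes r_nonneg: "r \<ge> 0"
    and F_cont: "\<And>i. i \<le> m \<Longrightarrow> continuous_on UNIV (\<lambda>(t, x). F i t x)"
    and F_lipschitz: "\<And>i. i \<le> m \<Longrightarrow> loc_lipschitz_in_space (F i)"
    and \<delta>_meas: "\<And>i. i \<in> {1..m} \<Longrightarrow> \<delta> i \<in> borel_measurable lebesgue"
    and \<delta>_range: "\<And>i t. i \<in> {1..m} \<Longrightarrow> \<delta> i t \<in> {0..r}"
    and p_gt_q: "p > q" and q_ge_1: "q \<ge> 1"
    and \<alpha>_pos: "\<And>i. i \<le> m \<Longrightarrow> \<alpha> i > 0"
    and \<beta>_meas: "\<And>i. i \<le> m \<Longrightarrow> \<beta> i \<in> borel_measurable lebesgue"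
    and \<beta>_nonneg: "\<And>i t. i \<le> m \<Longrightarrow> \<beta> i t \<ge> 0"
    and dissipative: "\<And>t x. F 0 t x \<bullet> x \<le> - \<alpha> 0 * norm x powr (p + 1) + \<beta> 0 t"
    and growth: "\<And>i t x. i \<in> {1..m} \<Longrightarrow> norm (F i t x) \<le> \<alpha> i * norm x powr q + \<beta> i t"
    and M_pos: "M > 0" and N_pos: "N > 0"
    and \<beta>_int: "\<And>s t. s < t \<Longrightarrow>
           (\<Sum>i\<le>m. \<integral>\<^sup>+\<mu>\<in>{s..t}. ennreal (\<beta> i \<mu>) \<partial>lebesgue) \<le> ennreal (M * (t - s) + N)"
begin

text \<open>The hypothesis bounds nonnegative integrals, so its finiteness already yields local
  integrability; the bound is then carried over to the gauge integral used in the estimates.\<close>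

lemma \<beta>_sum_integrable:
  assumes "s < t"
  shows "(\<lambda>\<mu>. \<Sum>i\<le>m. \<beta> i \<mu>) integrable_on {s..t}"
    and "integral {s..t} (\<lambda>\<mu>. \<Sum>i\<le>m. \<beta> i \<mu>) \<le> M * (t - s) + N"
proof -
  let ?f = "\<lambda>\<mu>. (\<Sum>i\<le>m. \<beta> i \<mu>) * indicator {s..t} \<mu>"
  have meas: "?f \<in> borel_measurable lebesgue"
    by (intro borel_measurable_times borel_measurable_sum borel_measurable_indicator) (auto intro: \<beta>_meas)
  have nn: "?f \<mu> \<ge> 0" for \<mu>
    by (auto intro!: mult_nonneg_nonneg sum_nonneg \<beta>_nonneg)
  have "(\<integral>\<^sup>+\<mu>. ennreal (?f \<mu>) \<partial>lebesgue)
      = (\<integral>\<^sup>+\<mu>. (\<Sum>i\<le>m. ennreal (\<beta> i \<mu>) * indicator {s..t} \<mu>) \<partial>lebesgue)"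
    by (intro nn_integral_cong) (auto simp: indicator_def intro!: sum_ennreal[symmetric] \<beta>_nonneg)
  also have "\<dots> = (\<Sum>i\<le>m. \<integral>\<^sup>+\<mu>\<in>{s..t}. ennreal (\<beta> i \<mu>) \<partial>lebesgue)"
    by (intro nn_integral_sum borel_measurable_times_ennreal borel_measurable_indicator
        measurable_compose[OF \<beta>_meas measurable_ennreal]) auto
  also have "\<dots> \<le> ennreal (M * (t - s) + N)"
    by (rule \<beta>_int[OF assms])
  finally have le: "(\<integral>\<^sup>+\<mu>. ennreal (?f \<mu>) \<partial>lebesgue) \<le> ennreal (M * (t - s) + N)" .
  have "integrable lebesgue ?f"
    by (rule integrableI_nonneg[OF meas]) (use nn le in \<open>auto simp: le_less_trans\<close>)
  then have si: "set_integrable lebesgue {s..t} (\<lambda>\<mu>. \<Sum>i\<le>m. \<beta> i \<mu>)"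
    by (simp add: set_integrable_def mult.commute)
  then show "(\<lambda>\<mu>. \<Sum>i\<le>m. \<beta> i \<mu>) integrable_on {s..t}"
    by (rule set_lebesgue_integral_eq_integral(1))
  have "integral {s..t} (\<lambda>\<mu>. \<Sum>i\<le>m. \<beta> i \<mu>) = integral\<^sup>L lebesgue ?f"
    by (simp add: set_lebesgue_integral_eq_integral(2)[OF si, symmetric] set_lebesgue_integral_def mult.commute)
  also have "\<dots> = enn2real (\<integral>\<^sup>+\<mu>. ennreal (?f \<mu>) \<partial>lebesgue)"
    by (rule integral_eq_nn_integral[OF meas]) (use nn in auto)
  also have "\<dots> \<le> M * (t - s) + N"
    using le assms M_pos N_pos by (intro enn2real_leI) auto
  finally show "integral {s..t} (\<lambda>\<mu>. \<Sum>i\<le>m. \<beta> i \<mu>) \<le> M * (t - s) + N" .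
qed

text \<open>
  Above such a level \<open>K\<close> the drift \<open>- K - M\<close> overcompensates the average growth \<open>M\<close> of the forcing,
  even if the delayed states have size \<open>K + N + 1\<close> and the present state only \<open>K / 2\<close>.
\<close>

definition large :: "real \<Rightarrow> bool" where
  "large K \<longleftrightarrow> K \<ge> 2 \<and> K \<ge> 2 * N + 1 \<and>
     - \<alpha> 0 * (K / 2) powr p + (\<Sum>i=1..m. \<alpha> i) * (K + N + 1) powr q \<le> - K - M"

lemma eventually_large:
  obtains R where "R > 0" "\<And>K. K \<ge> R \<Longrightarrow> large K"
proof
  define A where "A = (\<Sum>i=1..m. \<alpha> i)"
  have A: "A \<ge> 0" unfolding A_def by (intro sum_nonneg) (use \<alpha>_pos in \<open>auto intro: less_imp_le\<close>)
  \<comment> \<open>\<open>c\<close> is chosen so that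
    \<open>\<alpha> 0 / 2 powr p * c = A * 2 powr q + 1 + M\<close>; the three summands pay for the
    delayed terms, for \<open>K\<close> and for \<open>M\<close>.\<close>
  define c where "c = (A * 2 powr q + 1 + M) * 2 powr p / \<alpha> 0"
  have \<alpha>0: "\<alpha> 0 > 0" using \<alpha>_pos by simp
  have c: "c > 0" unfolding c_def using A M_pos \<alpha>0
    by (intro divide_pos_pos mult_pos_pos add_nonneg_pos) auto
  \<comment> \<open>The first entry gives \<open>K + N + 1 \<le> 2 * K\<close> and the two lower
    bounds in \<open>large\<close>; the second gives \<open>K powr (p - q) \<ge> c\<close>.\<close>
  define R where "R = max (2 + 2 * N) (c powr (1 / (p - q)))"
  show "R > 0" using N_pos by (simp add: R_def)
  fix K assume "K \<ge> R"
  then have K: "K \<ge> 2" "K \<ge> 2 * N + 1" "K \<ge> c powr (1 / (p - q))" "K \<ge> N + 1"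
    using N_pos by (auto simp: R_def)
  have "(K + N + 1) powr q \<le> (2 * K) powr q"
    using K N_pos q_ge_1 by (intro powr_mono2) auto
  also have "\<dots> = 2 powr q * K powr q" using K by (simp add: powr_mult)
  finally have 1: "A * (K + N + 1) powr q \<le> A * 2 powr q * K powr q"
    using A by (simp add: mult_left_mono mult.assoc)
  have "K powr 1 \<le> K powr q" using K q_ge_1 by (intro powr_mono) auto
  then have 2: "K \<le> K powr q" using K by simp
  have 3: "M \<le> M * K powr q" using 2 K M_pos by simp
  have "c = (c powr (1 / (p - q))) powr (p - q)"
    using c p_gt_q by (simp add: powr_powr)
  also have "\<dots> \<le> K powr (p - q)"
    using K p_gt_q by (intro powr_mono2) auto
  finally have "c * K powr q \<le> K powr (p - q) * K powr q"
    by (intro mult_right_mono) auto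
  also have "\<dots> = K powr p" by (simp flip: powr_add)
  finally have "\<alpha> 0 / 2 powr p * (c * K powr q) \<le> \<alpha> 0 / 2 powr p * K powr p"
    using \<alpha>0 by (intro mult_left_mono) auto
  moreover have "\<alpha> 0 / 2 powr p * (c * K powr q) = (A * 2 powr q + 1 + M) * K powr q"
    using \<alpha>0 by (simp add: c_def)
  moreover have "\<alpha> 0 / 2 powr p * K powr p = \<alpha> 0 * (K / 2) powr p"
    using K by (simp add: powr_divide)
  ultimately have "A * 2 powr q * K powr q + K powr q + M * K powr q \<le> \<alpha> 0 * (K / 2) powr p"
    by (simp add: algebra_simps)
  then show "large K"
    using K 1 2 3 unfolding large_def A_def by linarith
qed

text \<open>The radial speed is at most \<open>- K - M\<close> plus the sum of the
  \<open>\<beta> i\<close>. That sum integrates to at most \<open>M * (t - s) + N\<close>, so the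
  two terms with \<open>M\<close> cancel and only the excess \<open>N\<close> remains.\<close>

lemma barrier:
  assumes sol: "solves_upto r m F \<delta> \<tau> \<phi> b x" and "large K"
    and st: "\<tau> \<le> s" "s \<le> t" "t \<le> b"
    and upper: "\<And>u. s - r \<le> u \<Longrightarrow> u \<le> t \<Longrightarrow> norm (x u) \<le> K + N + 1"
    and lower: "\<And>u. s \<le> u \<Longrightarrow> u \<le> t \<Longrightarrow> K / 2 \<le> norm (x u)"
  shows "norm (x t) \<le> norm (x s) - K * (t - s) + N"
proof (cases "s = t")
  case True
  then show ?thesis using N_pos by simp
next
  case False
  with st have "s < t" by simp
  have K: "K \<ge> 2" and Kineq: "- \<alpha> 0 * (K / 2) powr p + (\<Sum>i=1..m. \<alpha> i) * (K + N + 1) powr q \<le> - K - M"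
    using \<open>large K\<close> by (auto simp: large_def)
  let ?g = "delay_rhs m F \<delta> x"
  have g: "?g absolutely_integrable_on {\<tau>..b}"
    and cont: "continuous_on {\<tau> - r..b} x"
    and eq: "\<And>u. u \<in> {\<tau>..b} \<Longrightarrow> x u = \<phi> 0 + integral {\<tau>..u} ?g"
    using sol by (auto simp: solves_upto_def)
  have gst: "?g absolutely_integrable_on {s..t}"
    by (rule absolutely_integrable_on_subinterval[OF g]) (use st in auto)
  have cst: "continuous_on {s..t} x"
    by (rule continuous_on_subset[OF cont]) (use st r_nonneg in auto)
  have incr: "x v = x u + integral {u..v} ?g" if "s \<le> u" "u \<le> v" "v \<le> t" for u v
  proof -
    have "?g integrable_on {\<tau>..v}"
      using absolutely_integrable_on_subinterval[OF g, of \<tau> v] that st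
      by (auto simp: absolutely_integrable_on_def)
    then have "integral {\<tau>..u} ?g + integral {u..v} ?g = integral {\<tau>..v} ?g"
      using that st by (intro Henstock_Kurzweil_Integration.integral_combine) auto
    then show ?thesis using eq[of u] eq[of v] that st by (simp add: algebra_simps)
  qed
  have pos: "norm (x u) \<ge> 1" if "s \<le> u" "u \<le> t" for u
    using lower[OF that] K by simp
  have nz: "x u \<noteq> 0" if "s \<le> u" "u \<le> t" for u
    using pos[OF that] by auto
  let ?h = "\<lambda>u. ?g u \<bullet> sgn (x u)"
  note h = norm_increment_le_integral_sgn[OF \<open>s \<le> t\<close> cst gst incr nz]
  have "integral {s..t} ?h \<le> integral {s..t} (\<lambda>u. (- K - M) + (\<Sum>i\<le>m. \<beta> i u))"
  proof (rule integral_le)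
    show "?h integrable_on {s..t}" using h(1) by (simp add: absolutely_integrable_on_def)
    show "(\<lambda>u. (- K - M) + (\<Sum>i\<le>m. \<beta> i u)) integrable_on {s..t}"
      by (intro integrable_add integrable_const_ivl \<beta>_sum_integrable \<open>s < t\<close>)
    fix u assume u: "u \<in> {s..t}"
    let ?n = "norm (x u)"
    have n: "?n \<ge> 1" "?n \<ge> K / 2" using pos lower u by auto
    \<comment> \<open>Dividing by \<open>?n\<close> lowers the exponent \<open>p + 1\<close> to
      \<open>p\<close>; since \<open>K \<ge> 2\<close> forces \<open>?n \<ge> 1\<close>, the forcing
      \<open>\<beta> 0 u\<close> does not grow.\<close>
    have "F 0 u (x u) \<bullet> sgn (x u) = (F 0 u (x u) \<bullet> x u) / ?n"
      by (simp add: sgn_div_norm divide_inverse)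
    also have "\<dots> \<le> (- \<alpha> 0 * ?n powr (p + 1) + \<beta> 0 u) / ?n"
      using n by (intro divide_right_mono dissipative) auto
    also have "\<dots> = - \<alpha> 0 * ?n powr p + \<beta> 0 u / ?n"
      using n by (simp add: powr_add diff_divide_distrib)
    also have "\<dots> \<le> - \<alpha> 0 * (K / 2) powr p + \<beta> 0 u"
    proof (intro add_mono)
      have "(K / 2) powr p \<le> ?n powr p" using n K p_gt_q q_ge_1 by (intro powr_mono2) auto
      then show "- \<alpha> 0 * ?n powr p \<le> - \<alpha> 0 * (K / 2) powr p" using \<alpha>_pos[of 0] by simp
      show "\<beta> 0 u / ?n \<le> \<beta> 0 u"
        using n \<beta>_nonneg[of 0 u] by (simp add: divide_le_eq mult_left_le mult_le_cancel_left1)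
    qed
    finally have 0: "F 0 u (x u) \<bullet> sgn (x u) \<le> - \<alpha> 0 * (K / 2) powr p + \<beta> 0 u" .
    have i: "F i u (x (u - \<delta> i u)) \<bullet> sgn (x u) \<le> \<alpha> i * (K + N + 1) powr q + \<beta> i u"
      if "i \<in> {1..m}" for i
    proof -
      have "F i u (x (u - \<delta> i u)) \<bullet> sgn (x u) \<le> norm (F i u (x (u - \<delta> i u)))"
        using norm_cauchy_schwarz[of "F i u (x (u - \<delta> i u))" "sgn (x u)"]
        by (simp add: norm_sgn split: if_splits)
      also have "\<dots> \<le> \<alpha> i * norm (x (u - \<delta> i u)) powr q + \<beta> i u"
        by (rule growth[OF that])
      also have "norm (x (u - \<delta> i u)) powr q \<le> (K + N + 1) powr q"
        using upper[of "u - \<delta> i u"] \<delta>_range[OF that, of u] u q_ge_1 by (intro powr_mono2) auto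
      finally show ?thesis using \<alpha>_pos[of i] that by simp
    qed
    have "?h u = F 0 u (x u) \<bullet> sgn (x u) + (\<Sum>i=1..m. F i u (x (u - \<delta> i u)) \<bullet> sgn (x u))"
      by (simp add: delay_rhs_def inner_add_left inner_sum_left)
    also have "\<dots> \<le> (- \<alpha> 0 * (K / 2) powr p + \<beta> 0 u) + (\<Sum>i=1..m. \<alpha> i * (K + N + 1) powr q + \<beta> i u)"
      by (intro add_mono sum_mono 0 i)
    also have "\<dots> = (- \<alpha> 0 * (K / 2) powr p + (\<Sum>i=1..m. \<alpha> i) * (K + N + 1) powr q)
        + (\<beta> 0 u + (\<Sum>i=1..m. \<beta> i u))"
      by (simp add: sum.distrib sum_distrib_right)
    also have "\<beta> 0 u + (\<Sum>i=1..m. \<beta> i u) = (\<Sum>i\<le>m. \<beta> i u)"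
      by (simp add: atMost_atLeast0 sum.atLeast_Suc_atMost[of 0 m])
    finally show "?h u \<le> (- K - M) + (\<Sum>i\<le>m. \<beta> i u)" using Kineq by linarith
  qed
  also have "\<dots> = (- K - M) * (t - s) + integral {s..t} (\<lambda>u. \<Sum>i\<le>m. \<beta> i u)"
    using \<open>s < t\<close> by (subst integral_add) (auto intro: \<beta>_sum_integrable)
  also have "\<dots> \<le> (- K - M) * (t - s) + (M * (t - s) + N)"
    by (intro add_left_mono \<beta>_sum_integrable \<open>s < t\<close>)
  finally show ?thesis using h(2) by (simp add: algebra_simps)
qed

lemma bounded_step:
  assumes sol: "solves_upto r m F \<delta> \<tau> \<phi> b x" and "large K"
    and "\<tau> \<le> s" "s \<le> b"
    and hist: "\<And>u. s - r \<le> u \<Longrightarrow> u \<le> s \<Longrightarrow> norm (x u) \<le> K"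
  shows "\<And>t. s \<le> t \<Longrightarrow> t \<le> b \<Longrightarrow> norm (x t) < K + N + 1"
    and "\<And>t. s + 1 \<le> t \<Longrightarrow> t \<le> b \<Longrightarrow> norm (x t) \<le> K / 2 + N"
proof -
  have K: "K \<ge> 2" "K \<ge> 2 * N + 1" using \<open>large K\<close> by (auto simp: large_def)
  have cont: "continuous_on {c..d} (\<lambda>t. norm (x t))" if "s - r \<le> c" "d \<le> b" for c d
  proof -
    have "continuous_on {\<tau> - r..b} x" using sol by (simp add: solves_upto_def)
    then show ?thesis
      by (intro continuous_on_norm, elim continuous_on_subset) (use assms that in auto)
  qed
  show less: "norm (x t) < K + N + 1" if "s \<le> t" "t \<le> b" for t
  proof (rule ccontr)
    assume "\<not> norm (x t) < K + N + 1"
    \<comment> \<open>Between the last time \<open>w\<close> at level \<open>K\<close> and the first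
      time \<open>u\<close> at level \<open>K + N + 1\<close> the barrier applies and allows a rise
      of at most \<open>N\<close>, whereas the levels differ by \<open>N + 1\<close>.\<close>
    with first_time_eq[of s t "\<lambda>t. norm (x t)" "K + N + 1"] cont[of s t] hist[of s] that r_nonneg N_pos
    obtain u where u: "s < u" "u \<le> t" "norm (x u) = K + N + 1"
      "\<And>v. s \<le> v \<Longrightarrow> v < u \<Longrightarrow> norm (x v) < K + N + 1"
      by (smt (verit))
    with last_time_eq[of s u "\<lambda>t. norm (x t)" K] cont[of s u] hist[of s] that r_nonneg N_pos
    obtain w where w: "s \<le> w" "w < u" "norm (x w) = K" "\<And>v. w < v \<Longrightarrow> v \<le> u \<Longrightarrow> K < norm (x v)"
      by (smt (verit))
    have "norm (x u) \<le> norm (x w) - K * (u - w) + N"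
    proof (rule barrier[OF sol \<open>large K\<close>])
      fix v assume "w - r \<le> v" "v \<le> u"
      then show "norm (x v) \<le> K + N + 1"
        using hist[of v] u(3) u(4)[of v] w(1) N_pos by (smt (verit))
    next
      fix v assume "w \<le> v" "v \<le> u"
      then show "K / 2 \<le> norm (x v)" using w(3) w(4)[of v] K by (cases "v = w") auto
    qed (use u w that assms in auto)
    moreover have "K * (u - w) \<ge> 0" using w K by simp
    ultimately show False using u w by simp
  qed
  have upper: "norm (x u) \<le> K + N + 1" if "s - r \<le> u" "u \<le> b" for u
    using hist[of u] less[of u] that N_pos by (cases "u \<le> s") auto
  fix t assume t: "s + 1 \<le> t" "t \<le> b"
  \<comment> \<open>If the norm stayed above \<open>K / 2\<close> for a whole time unit, the barrier
    would bring it from at most \<open>K\<close> down to at most \<open>N\<close>, which is below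
    \<open>K / 2\<close> by \<open>K \<ge> 2 * N + 1\<close>.\<close>
  obtain w where w: "s \<le> w" "w \<le> s + 1" "norm (x w) \<le> K / 2"
  proof (rule ccontr)
    assume "\<not> thesis"
    with that have "norm (x u) > K / 2" if "s \<le> u" "u \<le> s + 1" for u
      using that by fastforce
    then have "norm (x (s + 1)) \<le> norm (x s) - K * (s + 1 - s) + N"
      by (intro barrier[OF sol \<open>large K\<close>] upper) (use assms t in \<open>auto intro: less_imp_le\<close>)
    moreover have "norm (x s) \<le> K" using hist r_nonneg by simp
    ultimately have "norm (x (s + 1)) \<le> K / 2" using K by simp
    then show False using that[of "s + 1"] \<open>\<not> thesis\<close> by simp
  qed
  show "norm (x t) \<le> K / 2 + N"
  proof (rule ccontr)
    assume *: "\<not> norm (x t) \<le> K / 2 + N"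
    \<comment> \<open>From the last time at level \<open>K / 2\<close> onwards the barrier applies
      up to \<open>t\<close>, so the rise above that level is at most \<open>N\<close>.\<close>
    with last_time_eq[of w t "\<lambda>t. norm (x t)" "K / 2"] cont[of w t] w t N_pos r_nonneg
    obtain v where v: "w \<le> v" "v < t" "norm (x v) = K / 2" "\<And>u. v < u \<Longrightarrow> u \<le> t \<Longrightarrow> K / 2 < norm (x u)"
      by (smt (verit))
    then have "K / 2 \<le> norm (x u)" if "v \<le> u" "u \<le> t" for u
      using that v(3) v(4)[of u] by (cases "u = v") fastforce+
    then have "norm (x t) \<le> norm (x v) - K * (t - v) + N"
      by (intro barrier[OF sol \<open>large K\<close>] upper) (use assms t v w in auto)
    moreover have "K * (t - v) \<ge> 0" using v K by simp
    ultimately show False using * v by simp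
  qed
qed

text \<open>A window of length \<open>r + 1\<close> turns a history bound \<open>K\<close> into
  \<open>K / 2 + N\<close>: one unit of time for the fall and \<open>r\<close> more to fill a
  complete history. Iteration gives geometric decay to a fixed level.\<close>

lemma decay_estimate:
  obtains \<kappa> \<rho> where "\<kappa> > 0" "\<rho> > 0"
    "\<And>\<tau> \<phi> b x t. continuous_on {-r..0} \<phi> \<Longrightarrow> solves_upto r m F \<delta> \<tau> \<phi> b x \<Longrightarrow> \<tau> \<le> t \<Longrightarrow> t \<le> b
       \<Longrightarrow> norm (x t) \<le> 2 * hist_norm r \<phi> * exp (- \<kappa> * (t - \<tau>)) + \<rho>"
proof -
  obtain R where R: "R > 0" "\<And>K. K \<ge> R \<Longrightarrow> large K" by (rule eventually_large) blast
  \<comment> \<open>\<open>c \<ge> R\<close> keeps every bound \<open>K n\<close> large, and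
    \<open>c \<ge> 2 * N\<close> gives \<open>K n / 2 + N \<le> K (Suc n)\<close>.\<close>
  define c where "c = max R (2 * N)"
  define h where "h = r + 1"
  have h: "h \<ge> 1" using r_nonneg by (simp add: h_def)
  show ?thesis
  proof
    show "ln 2 / h > 0" using h by simp
    show "c + N + 1 > 0" using R N_pos by (simp add: c_def)
    fix \<tau> \<phi> b x t
    assume \<phi>: "continuous_on {-r..0} \<phi>" and sol: "solves_upto r m F \<delta> \<tau> \<phi> b x" and t: "\<tau> \<le> t" "t \<le> b"
    define H where "H = hist_norm r \<phi>"
    have "norm (\<phi> 0) \<le> H" unfolding H_def by (rule norm_le_hist_norm[OF \<phi>]) (use r_nonneg in auto)
    then have H: "H \<ge> 0" using norm_ge_zero order_trans by blast
    define K where "K n = H / 2 ^ n + c" for n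
    have K: "K n \<ge> R" for n using H by (simp add: K_def c_def add_increasing)
    have step: "norm (x u) \<le> K n"
      if "\<tau> + real n * h - r \<le> u" "u \<le> \<tau> + real n * h" "u \<le> b" "\<tau> + real n * h \<le> b" for n u
      using that
    proof (induction n arbitrary: u)
      case 0
      have "x u = \<phi> (u - \<tau>)"
        using sol 0 unfolding solves_upto_def
        by (metis (no_types, lifting) add.commute add.right_neutral atLeastAtMost_iff diff_add_cancel
            diff_le_0_iff_le diff_left_mono le_diff_eq mult_zero_left of_nat_0 uminus_add_conv_diff)
      moreover have "norm (\<phi> (u - \<tau>)) \<le> H"
        unfolding H_def by (rule norm_le_hist_norm[OF \<phi>]) (use 0 in auto)
      ultimately show ?case using R by (simp add: K_def c_def add_increasing2)
    next
      case (Suc n)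
      let ?s = "\<tau> + real n * h"
      have s: "?s + 1 \<le> u" using Suc.prems by (simp add: h_def algebra_simps)
      have "norm (x u) \<le> K n / 2 + N"
      proof (rule bounded_step(2)[OF sol R(2)[OF K]])
        show "\<tau> \<le> ?s" using h by simp
        show "?s \<le> b" using s Suc.prems by simp
        fix v assume "?s - r \<le> v" "v \<le> ?s"
        then show "norm (x v) \<le> K n" using s Suc.prems by (intro Suc.IH) auto
      qed (use s Suc.prems in auto)
      also have "\<dots> \<le> K (Suc n)" by (simp add: K_def c_def max_def field_simps)
      finally show ?case .
    qed
    \<comment> \<open>\<open>n\<close> counts the complete windows before \<open>t\<close>. Rounding
      down loses at most one halving, which is the factor 2 in the estimate.\<close>
    define n where "n = nat \<lfloor>(t - \<tau>) / h\<rfloor>"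
    have "real n = of_int \<lfloor>(t - \<tau>) / h\<rfloor>" using t h by (simp add: n_def)
    then have "real n \<le> (t - \<tau>) / h" "(t - \<tau>) / h < real n + 1" by linarith+
    then have n: "\<tau> + real n * h \<le> t" "(t - \<tau>) / h \<le> real n + 1"
      using h by (auto simp: field_simps)
    have "norm (x t) < K n + N + 1"
      by (rule bounded_step(1)[OF sol R(2)[OF K], of "\<tau> + real n * h"]) (use n t h step in auto)
    moreover have "H / 2 ^ n \<le> 2 * H * exp (- (ln 2 / h) * (t - \<tau>))"
    proof -
      have "(1/2) ^ n = 2 * exp (- ln 2 * (real n + 1))"
        by (simp add: exp_diff exp_of_nat_mult exp_minus power_one_over field_simps flip: exp_add)
      also have "\<dots> \<le> 2 * exp (- ln 2 * ((t - \<tau>) / h))"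
        using mult_left_mono[OF n(2), of "ln 2"] by simp
      finally have "(1/2) ^ n \<le> 2 * exp (- (ln 2 / h) * (t - \<tau>))" by simp
      then show ?thesis using mult_left_mono[OF _ H] by (fastforce simp: power_one_over field_simps)
    qed
    ultimately show "norm (x t) \<le> 2 * hist_norm r \<phi> * exp (- (ln 2 / h) * (t - \<tau>)) + (c + N + 1)"
      unfolding H_def K_def by simp
  qed
qed

end

section \<open>Existence and uniqueness for bounded, globally Lipschitz right hand sides\<close>

text \<open>\<open>X\<close> is taken Borel measurable because it is composed with a merely Lebesgue
  measurable argument; a Lebesgue measurable outer function would not compose.\<close>

lemma measurable_delayed_composition:
  fixes G :: "real \<Rightarrow> 'a :: euclidean_space \<Rightarrow> 'b :: euclidean_space"
  assumes "continuous_on UNIV (\<lambda>(t, x). G t x)"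
    and X: "X \<in> borel_measurable borel" and d: "d \<in> borel_measurable lebesgue"
  shows "(\<lambda>t. G t (X (t - d t))) \<in> borel_measurable lebesgue"
proof -
  have id: "(\<lambda>t::real. t) \<in> borel_measurable lebesgue"
    using id_borel_measurable_lebesgue by (simp add: id_def)
  have "(\<lambda>t. X (t - d t)) \<in> borel_measurable lebesgue"
    by (rule measurable_compose[OF _ X]) (intro borel_measurable_diff id d)
  then have "(\<lambda>t. (t, X (t - d t))) \<in> borel_measurable lebesgue"
    by (intro borel_measurable_Pair id)
  moreover have "(\<lambda>(t, x). G t x) \<in> borel_measurable borel"
    by (rule borel_measurable_continuous_onI) fact
  ultimately show ?thesis
    using measurable_compose[of "\<lambda>t. (t, X (t - d t))" lebesgue borel "\<lambda>(t, x). G t x" borel] by simp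
qed

text \<open>
  Bielecki's device: the fixed point operator acts on \<open>w t = exp (- \<mu> * (t - \<tau>)) *\<^sub>R x t\<close>, extended
  constantly beyond the end points, and the weight turns it into a contraction on the whole of \<open>{\<tau>..b}\<close>.
\<close>

locale lipschitz_delay_system =
  fixes r \<tau> b B L :: real
    and m :: nat
    and G :: "nat \<Rightarrow> real \<Rightarrow> real ^ 'n \<Rightarrow> real ^ 'n"
    and \<delta> :: "nat \<Rightarrow> real \<Rightarrow> real"
    and \<phi> :: "real \<Rightarrow> real ^ 'n"
  assumes r_nonneg: "r \<ge> 0" and \<tau>_le: "\<tau> \<le> b"
    and G_cont: "\<And>i. i \<le> m \<Longrightarrow> continuous_on UNIV (\<lambda>(t, x). G i t x)"
    and G_bound: "\<And>i t y. i \<le> m \<Longrightarrow> t \<in> {\<tau>..b} \<Longrightarrow> norm (G i t y) \<le> B"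
    and G_lipschitz: "\<And>i t y z. i \<le> m \<Longrightarrow> t \<in> {\<tau>..b} \<Longrightarrow> norm (G i t y - G i t z) \<le> L * norm (y - z)"
    and L_nonneg: "L \<ge> 0"
    and \<delta>_meas: "\<And>i. i \<in> {1..m} \<Longrightarrow> \<delta> i \<in> borel_measurable lebesgue"
    and \<delta>_range: "\<And>i t. i \<in> {1..m} \<Longrightarrow> \<delta> i t \<in> {0..r}"
    and \<phi>_cont: "continuous_on {-r..0} \<phi>"
begin

text \<open>\<open>(real m + 1) * L\<close> is the Lipschitz constant of the whole right hand side;
  \<open>L + 1\<close> keeps the weight positive for \<open>L = 0\<close>, and the factor 2 produces
  the contraction constant \<open>1/2\<close>.\<close>

definition \<mu> :: real where "\<mu> = 2 * ((real m + 1) * (L + 1))"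

text \<open>Clamping time makes the Picard images bounded and continuous on the whole line, so that
  Banach's theorem applies in the complete type of such functions.\<close>

definition cl :: "real \<Rightarrow> real" where "cl t = max \<tau> (min b t)"

text \<open>The argument of \<phi> is clamped because \<phi> is controlled only on
  \<open>{-r..0}\<close>. For arbitrary \<open>w\<close> the result may jump at \<tau>, hence Borel
  measurability instead of continuity in what follows.\<close>

definition unweight :: "(real \<Rightarrow> real ^ 'n) \<Rightarrow> real \<Rightarrow> real ^ 'n" where
  "unweight w t = (if t \<le> \<tau> then \<phi> (max (-r) (min 0 (t - \<tau>))) else exp (\<mu> * (t - \<tau>)) *\<^sub>R w t)"

definition picard :: "(real \<Rightarrow> real ^ 'n) \<Rightarrow> real \<Rightarrow> real ^ 'n" where
  "picard w t = exp (- \<mu> * (cl t - \<tau>)) *\<^sub>R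
     (\<phi> 0 + integral {\<tau>..cl t} (delay_rhs m G \<delta> (unweight w)))"

lemma cl_range: "cl t \<in> {\<tau>..b}" and cl_id: "t \<in> {\<tau>..b} \<Longrightarrow> cl t = t"
  using \<tau>_le by (auto simp: cl_def)

lemma continuous_cl: "continuous_on A cl"
  unfolding cl_def[abs_def] by (intro continuous_intros)

lemma \<mu>_pos: "\<mu> > 0"
  using L_nonneg by (simp add: \<mu>_def)

lemma unweight_measurable:
  assumes "continuous_on UNIV w"
  shows "unweight w \<in> borel_measurable borel"
  unfolding unweight_def[abs_def]
proof (rule measurable_If)
  show "(\<lambda>t. \<phi> (max (-r) (min 0 (t - \<tau>)))) \<in> borel_measurable borel"
    by (intro borel_measurable_continuous_onI continuous_on_compose2[OF \<phi>_cont] continuous_intros)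
      (use r_nonneg in auto)
  show "(\<lambda>t. exp (\<mu> * (t - \<tau>)) *\<^sub>R w t) \<in> borel_measurable borel"
    by (intro borel_measurable_continuous_onI continuous_intros assms)
qed simp

lemma rhs_bound: "t \<in> {\<tau>..b} \<Longrightarrow> norm (delay_rhs m G \<delta> x t) \<le> B + real m * B"
  unfolding delay_rhs_def
  by (intro norm_triangle_le add_mono G_bound order_trans[OF norm_sum] sum_bounded_above[THEN order_trans])
    (auto intro: G_bound)

lemma rhs_integrable:
  assumes "X \<in> borel_measurable borel" "c \<le> b"
  shows "delay_rhs m G \<delta> X absolutely_integrable_on {\<tau>..c}"
proof (rule measurable_bounded_by_integrable_imp_absolutely_integrable)
  have "delay_rhs m G \<delta> X \<in> borel_measurable lebesgue"
    unfolding delay_rhs_def[abs_def]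
  proof (intro borel_measurable_add borel_measurable_sum)
    show "(\<lambda>t. G 0 t (X t)) \<in> borel_measurable lebesgue"
      using measurable_delayed_composition[of "G 0" X "\<lambda>_. 0"] G_cont assms by simp
  qed (auto intro!: measurable_delayed_composition assms G_cont \<delta>_meas)
  then show "delay_rhs m G \<delta> X \<in> borel_measurable (lebesgue_on {\<tau>..c})"
    by (rule measurable_restrict_space1)
  show "(\<lambda>_. B + real m * B) integrable_on {\<tau>..c}" by (rule integrable_const_ivl)
qed (use assms in \<open>auto intro!: rhs_bound\<close>)

lemma unweight_bcontfun_measurable:
  "unweight (apply_bcontfun w) \<in> borel_measurable borel"
  by (rule unweight_measurable) auto

lemma integrable_unweight:
  "c \<le> b \<Longrightarrow> delay_rhs m G \<delta> (unweight (apply_bcontfun w)) integrable_on {\<tau>..c}"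
  using rhs_integrable[OF unweight_bcontfun_measurable, of c w] by (simp add: absolutely_integrable_on_def)

lemma picard_bcontfun: "picard (apply_bcontfun w) \<in> bcontfun"
proof -
  have "continuous_on {\<tau>..b} (\<lambda>t. exp (- \<mu> * (t - \<tau>)) *\<^sub>R
      (\<phi> 0 + integral {\<tau>..t} (delay_rhs m G \<delta> (unweight (apply_bcontfun w)))))" (is "continuous_on _ ?f")
    by (intro continuous_intros indefinite_integral_continuous_1 integrable_unweight) simp
  then have "continuous_on UNIV (\<lambda>t. ?f (cl t))" "bounded (?f ` {\<tau>..b})"
    by (auto intro!: continuous_on_compose2[OF _ continuous_cl] compact_imp_bounded
        compact_continuous_image cl_range[simplified])
  then show ?thesis
    unfolding bcontfun_def picard_def[abs_def] using cl_range
    by (auto elim!: bounded_subset)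
qed

text \<open>The weight increases with time and histories coincide, so looking back by a delay costs
  nothing in the weighted norm.\<close>

lemma unweight_diff:
  assumes "s \<le> t"
  shows "norm (unweight (apply_bcontfun v) s - unweight (apply_bcontfun w) s) \<le> exp (\<mu> * (t - \<tau>)) * dist v w"
proof (cases "s \<le> \<tau>")
  case False
  then have "norm (unweight (apply_bcontfun v) s - unweight (apply_bcontfun w) s)
      = exp (\<mu> * (s - \<tau>)) * dist (apply_bcontfun v s) (apply_bcontfun w s)"
    by (simp add: unweight_def dist_norm flip: scaleR_diff_right)
  also have "\<dots> \<le> exp (\<mu> * (t - \<tau>)) * dist v w"
    using assms \<mu>_pos by (intro mult_mono dist_bounded) auto
  finally show ?thesis .
qed (simp add: unweight_def)

lemma rhs_diff:
  assumes "t \<in> {\<tau>..b}"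
  shows "norm (delay_rhs m G \<delta> (unweight (apply_bcontfun v)) t - delay_rhs m G \<delta> (unweight (apply_bcontfun w)) t)
    \<le> \<mu> / 2 * dist v w * exp (\<mu> * (t - \<tau>))"
proof -
  let ?v = "unweight (apply_bcontfun v)" and ?w = "unweight (apply_bcontfun w)"
  let ?E = "exp (\<mu> * (t - \<tau>)) * dist v w"
  have *: "norm (G i t (?v s) - G i t (?w s)) \<le> L * ?E" if "i \<le> m" "s \<le> t" for i s
    by (rule order_trans[OF G_lipschitz[OF that(1) assms] mult_left_mono[OF unweight_diff[OF that(2)] L_nonneg]])
  have "norm (delay_rhs m G \<delta> ?v t - delay_rhs m G \<delta> ?w t)
      = norm ((G 0 t (?v t) - G 0 t (?w t)) + (\<Sum>i=1..m. G i t (?v (t - \<delta> i t)) - G i t (?w (t - \<delta> i t))))"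
    by (simp add: delay_rhs_def sum_subtractf algebra_simps)
  also have "\<dots> \<le> L * ?E + (\<Sum>i=1..m. L * ?E)"
    by (intro norm_triangle_le add_mono order_trans[OF norm_sum] sum_mono *) (use \<delta>_range in auto)
  also have "\<dots> = (real m + 1) * L * ?E"
    by (simp add: algebra_simps)
  also have "\<dots> \<le> (real m + 1) * (L + 1) * ?E"
    by (intro mult_right_mono mult_left_mono) auto
  finally show ?thesis by (simp add: \<mu>_def algebra_simps)
qed

lemma picard_contraction:
  "norm (picard (apply_bcontfun v) t - picard (apply_bcontfun w) t) \<le> 1/2 * dist v w"
proof -
  let ?c = "cl t"
  let ?H = "\<lambda>w. delay_rhs m G \<delta> (unweight (apply_bcontfun w))"
  have c: "\<tau> \<le> ?c" "?c \<le> b" using cl_range[of t] by auto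
  \<comment> \<open>Integrating the exponential divides by \<mu> and leaves the factor
    \<open>1/2\<close>; the weight in \<open>picard\<close> then cancels the exponential at
    \<open>?c\<close>.\<close>
  have int: "((\<lambda>s. \<mu> / 2 * dist v w * exp (\<mu> * (s - \<tau>))) has_integral
      (1/2 * dist v w * exp (\<mu> * (?c - \<tau>)) - 1/2 * dist v w * exp (\<mu> * (\<tau> - \<tau>)))) {\<tau>..?c}"
    by (rule fundamental_theorem_of_calculus[OF c(1)])
      (auto intro!: derivative_eq_intros simp flip: has_real_derivative_iff_has_vector_derivative)
  have "norm (integral {\<tau>..?c} (?H v) - integral {\<tau>..?c} (?H w))
      = norm (integral {\<tau>..?c} (\<lambda>s. ?H v s - ?H w s))"
    using c by (simp add: Henstock_Kurzweil_Integration.integral_diff integrable_unweight)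
  also have "\<dots> \<le> integral {\<tau>..?c} (\<lambda>s. \<mu> / 2 * dist v w * exp (\<mu> * (s - \<tau>)))"
    using c int by (intro integral_norm_bound_integral rhs_diff integrable_diff integrable_unweight) auto
  also have "\<dots> \<le> 1/2 * dist v w * exp (\<mu> * (?c - \<tau>))"
    using integral_unique[OF int] by simp
  finally have "exp (- \<mu> * (?c - \<tau>)) * norm (integral {\<tau>..?c} (?H v) - integral {\<tau>..?c} (?H w))
      \<le> exp (- \<mu> * (?c - \<tau>)) * (1/2 * dist v w * exp (\<mu> * (?c - \<tau>)))"
    by (intro mult_left_mono) auto
  also have "\<dots> = 1/2 * dist v w" by (simp flip: exp_add)
  finally show ?thesis
    by (simp add: picard_def flip: scaleR_diff_right)
qed

lemma ex1_fixed_point: "\<exists>!w. Bcontfun (picard (apply_bcontfun w)) = w"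
proof (rule banach_fix_type[of "1/2"])
  show "\<forall>v w. dist (Bcontfun (picard (apply_bcontfun v))) (Bcontfun (picard (apply_bcontfun w))) \<le> 1/2 * dist v w"
    by (intro allI dist_bound)
      (use picard_contraction in \<open>simp add: Bcontfun_inverse[OF picard_bcontfun] dist_norm[of "picard _ _"]\<close>)
qed auto

lemma fixed_point_solves:
  assumes "Bcontfun (picard (apply_bcontfun w)) = w"
  shows "solves_upto r m G \<delta> \<tau> \<phi> b (unweight (apply_bcontfun w))"
proof -
  let ?x = "unweight (apply_bcontfun w)"
  have w: "apply_bcontfun w t = picard (apply_bcontfun w) t" for t
    using Bcontfun_inverse[OF picard_bcontfun, of w] assms by simp
  have hist: "?x t = \<phi> (t - \<tau>)" if "\<tau> - r \<le> t" "t \<le> \<tau>" for t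
    using that by (simp add: unweight_def max_def min_def)
  have eq: "?x t = \<phi> 0 + integral {\<tau>..t} (delay_rhs m G \<delta> ?x)" if "t \<in> {\<tau>..b}" for t
  proof (cases "t = \<tau>")
    case True
    then show ?thesis using hist[of \<tau>] r_nonneg by simp
  next
    case False
    then show ?thesis
      using that by (simp add: unweight_def[of _ t] w[of t] picard_def cl_id flip: exp_add)
  qed
  \<comment> \<open>For a fixed point the integral equation holds down to \<tau> with value
    \<open>\<phi> 0\<close>, so the two pieces match there and glue.\<close>
  have "continuous_on {\<tau> - r..\<tau>} ?x"
    by (subst continuous_on_cong[OF refl hist])
      (auto intro!: continuous_on_compose2[OF \<phi>_cont] continuous_intros)
  moreover have "continuous_on {\<tau>..b} ?x"
    by (subst continuous_on_cong[OF refl eq])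
      (auto intro!: continuous_intros indefinite_integral_continuous_1 integrable_unweight)
  ultimately have "continuous_on ({\<tau> - r..\<tau>} \<union> {\<tau>..b}) ?x"
    by (intro continuous_on_closed_Un) auto
  moreover have "{\<tau> - r..\<tau>} \<union> {\<tau>..b} = {\<tau> - r..b}"
    using r_nonneg \<tau>_le by auto
  ultimately show ?thesis
    using hist eq rhs_integrable[OF unweight_bcontfun_measurable, of b]
    by (auto simp: solves_upto_def)
qed

lemma ex_solution: "\<exists>x. solves_upto r m G \<delta> \<tau> \<phi> b x"
  using ex1_fixed_point fixed_point_solves by blast

text \<open>Every solution, once weighted and clamped, is a fixed point; hence uniqueness of the
  fixed point becomes uniqueness of solutions.\<close>

lemma solution_fixed_point:
  assumes sol: "solves_upto r m G \<delta> \<tau> \<phi> b x"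
  obtains w where "Bcontfun (picard (apply_bcontfun w)) = w"
    "\<And>t. t \<in> {\<tau> - r..b} \<Longrightarrow> unweight (apply_bcontfun w) t = x t"
proof -
  define w where "w = (\<lambda>t. exp (- \<mu> * (cl t - \<tau>)) *\<^sub>R x (cl t))"
  have cont: "continuous_on {\<tau>..b} (\<lambda>t. exp (- \<mu> * (t - \<tau>)) *\<^sub>R x t)" (is "continuous_on _ ?f")
    using sol r_nonneg unfolding solves_upto_def
    by (intro continuous_intros) (auto elim: continuous_on_subset)
  then have "continuous_on UNIV (\<lambda>t. ?f (cl t))" "bounded (?f ` {\<tau>..b})"
    by (auto intro!: continuous_on_compose2[OF _ continuous_cl] compact_imp_bounded
        compact_continuous_image cl_range[simplified])
  then have "w \<in> bcontfun"
    unfolding bcontfun_def w_def using cl_range by (auto elim!: bounded_subset)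
  then have w: "apply_bcontfun (Bcontfun w) = w" by (rule Bcontfun_inverse)
  have x: "unweight w t = x t" if "t \<in> {\<tau> - r..b}" for t
  proof (cases "t \<le> \<tau>")
    case True
    then have "t - \<tau> \<in> {-r..0}" using that by auto
    then have "x (\<tau> + (t - \<tau>)) = \<phi> (t - \<tau>)" using sol unfolding solves_upto_def by blast
    then show ?thesis using True that by (simp add: unweight_def max_def min_def)
  next
    case False
    then show ?thesis using that by (simp add: unweight_def w_def cl_id flip: exp_add)
  qed
  have "picard w t = w t" for t
  proof -
    have c: "cl t \<in> {\<tau>..b}" by (rule cl_range)
    have "integral {\<tau>..cl t} (delay_rhs m G \<delta> (unweight w)) = integral {\<tau>..cl t} (delay_rhs m G \<delta> x)"
    proof (rule integral_cong, rule delay_rhs_cong[of \<tau> r b])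
      fix u assume "\<tau> - r \<le> u" "u \<le> b"
      then show "unweight w u = x u" by (simp add: x)
    qed (use c r_nonneg \<delta>_range in auto)
    moreover have "x (cl t) = \<phi> 0 + integral {\<tau>..cl t} (delay_rhs m G \<delta> x)"
      using sol c by (simp add: solves_upto_def)
    ultimately show ?thesis by (simp add: picard_def w_def)
  qed
  then have "picard w = w" by blast
  then show ?thesis using that[of "Bcontfun w"] x by (simp add: w)
qed

lemma solution_unique:
  assumes "solves_upto r m G \<delta> \<tau> \<phi> b x" "solves_upto r m G \<delta> \<tau> \<phi> b y" "t \<in> {\<tau> - r..b}"
  shows "x t = y t"
  by (metis assms ex1_fixed_point solution_fixed_point)

end

section \<open>Truncation, well-posedness and maximal solutions\<close>

text \<open>The local constants are uniform over \<open>{a..b}\<close>, so only space has to be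
  localised; compactness of \<open>X\<close> and continuity in time turn them into one
  constant.\<close>

lemma loc_lipschitz_imp_lipschitz_on_compact:
  assumes "loc_lipschitz_in_space G" "continuous_on UNIV (\<lambda>(t, x). G t x)" "compact X"
  obtains L where "\<And>t. t \<in> {a..b} \<Longrightarrow> L-lipschitz_on X (G t)"
proof (rule local_lipschitz_compact_implies_lipschitz[OF _ \<open>compact X\<close>, of "{a..b}" G])
  show "local_lipschitz {a..b} X G"
  proof (rule local_lipschitzI)
    fix t x
    obtain e L where "e > 0" and L: "\<And>t. t \<in> {a..b} \<Longrightarrow> L-lipschitz_on (ball x e) (G t)"
      using assms(1) unfolding loc_lipschitz_in_space_def by meson
    have "L-lipschitz_on (cball x (e/2) \<inter> X) (G t)" if "t \<in> {a..b}" for t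
      by (rule lipschitz_on_subset[OF L[OF that]]) (use \<open>e > 0\<close> in auto)
    then show "\<exists>u>0. \<exists>L. \<forall>t\<in>cball t u \<inter> {a..b}. L-lipschitz_on (cball x u \<inter> X) (G t)"
      using \<open>e > 0\<close> by (intro exI[of _ "e/2"] conjI exI[of _ L]) auto
  qed
  show "continuous_on {a..b} (\<lambda>t. G t x)" for x
  proof -
    have "continuous_on {a..b} (\<lambda>t. (\<lambda>(t, x). G t x) (t, x))"
      by (intro continuous_on_compose2[OF assms(2)] continuous_intros) auto
    then show ?thesis by simp
  qed
qed (auto intro: that)

context dissipative_delay_system
begin

text \<open>The closest point map is a 1-Lipschitz retraction onto the ball, so composing with it
  keeps continuity and makes the field bounded and globally Lipschitz on compact time
  intervals.\<close>

definition truncated :: "real \<Rightarrow> nat \<Rightarrow> real \<Rightarrow> real ^ 'n \<Rightarrow> real ^ 'n" where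
  "truncated R i t y = F i t (closest_point (cball 0 R) y)"

lemma truncated_lipschitz_system:
  assumes "R > 0" "\<tau> \<le> b" "continuous_on {-r..0} \<phi>"
  shows "\<exists>B L. lipschitz_delay_system r \<tau> b B L m (truncated R) \<delta> \<phi>"
proof -
  let ?P = "closest_point (cball (0 :: real ^ 'n) R)"
  have ne: "cball (0 :: real ^ 'n) R \<noteq> {}" using \<open>R > 0\<close> by simp
  have P: "?P y \<in> cball 0 R" for y
    by (rule closest_point_in_set) (use ne in auto)
  have "\<exists>B. \<forall>t\<in>{\<tau>..b}. \<forall>y\<in>cball 0 R. norm (F i t y) \<le> B" if "i \<le> m" for i
  proof -
    have "compact ((\<lambda>(t, x). F i t x) ` ({\<tau>..b} \<times> cball 0 R))"
      by (intro compact_continuous_image compact_Times continuous_on_subset[OF F_cont[OF that]]) auto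
    then obtain B where "\<And>z. z \<in> (\<lambda>(t, x). F i t x) ` ({\<tau>..b} \<times> cball 0 R) \<Longrightarrow> norm z \<le> B"
      by (meson compact_imp_bounded bounded_iff)
    then show ?thesis by (metis (no_types, lifting) SigmaI case_prod_conv image_eqI)
  qed
  then obtain B where B: "\<And>i t y. i \<le> m \<Longrightarrow> t \<in> {\<tau>..b} \<Longrightarrow> y \<in> cball 0 R \<Longrightarrow> norm (F i t y) \<le> B i"
    by metis
  have "\<exists>L. \<forall>t\<in>{\<tau>..b}. L-lipschitz_on (cball 0 R) (F i t)" if "i \<le> m" for i
    using loc_lipschitz_imp_lipschitz_on_compact[OF F_lipschitz[OF that] F_cont[OF that] compact_cball]
    by metis
  then obtain L where L: "\<And>i t. i \<le> m \<Longrightarrow> t \<in> {\<tau>..b} \<Longrightarrow> (L i)-lipschitz_on (cball 0 R) (F i t)"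
    by metis
  define B' L' where "B' = Max (B ` {..m})" and "L' = Max (L ` {..m})"
  have B': "B i \<le> B'" and L': "L i \<le> L'" if "i \<le> m" for i
    using that by (auto simp: B'_def L'_def)
  have "L 0 \<ge> 0" using L[of 0 \<tau>] assms by (auto dest: lipschitz_on_nonneg)
  have "lipschitz_delay_system r \<tau> b B' L' m (truncated R) \<delta> \<phi>"
  proof
    fix i assume i: "i \<le> m"
    have "continuous_on UNIV (\<lambda>z. (\<lambda>(t, x). F i t x) (fst z, ?P (snd z)))"
      by (intro continuous_on_compose2[OF F_cont[OF i]] continuous_intros
          continuous_on_compose2[OF continuous_on_closest_point[OF convex_cball closed_cball ne, of UNIV]]) auto
    then show "continuous_on UNIV (\<lambda>(t, x). truncated R i t x)"
      by (simp add: truncated_def case_prod_beta)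
    fix t assume t: "t \<in> {\<tau>..b}"
    show "norm (truncated R i t y) \<le> B'" for y
      using B[OF i t P] B'[OF i] unfolding truncated_def by (rule order_trans)
    show "norm (truncated R i t y - truncated R i t z) \<le> L' * norm (y - z)" for y z
    proof -
      have "norm (truncated R i t y - truncated R i t z) \<le> L i * dist (?P y) (?P z)"
        using lipschitz_onD[OF L[OF i t] P P] by (simp add: truncated_def dist_norm)
      also have "\<dots> \<le> L' * dist y z"
        using closest_point_lipschitz[OF convex_cball closed_cball ne, of y z] L'[OF i] L'[of 0] \<open>L 0 \<ge> 0\<close>
        by (intro mult_mono) auto
      finally show ?thesis by (simp add: dist_norm)
    qed
  qed (use assms r_nonneg \<delta>_meas \<delta>_range L'[of 0] \<open>L 0 \<ge> 0\<close> in auto)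
  then show ?thesis by blast
qed

lemma truncated_eq: "norm y \<le> R \<Longrightarrow> truncated R i t y = F i t y"
  by (simp add: truncated_def closest_point_self)

text \<open>\<open>R\<close> depends on \<phi> but on neither \<tau> nor \<open>b\<close>, so it can
  be fixed as truncation radius beforehand. The \<open>+ 1\<close> in its choice makes the bound
  strict, as needed to exclude a first contact with the sphere.\<close>

lemma solution_bound:
  assumes "continuous_on {-r..0} \<phi>"
  obtains R where "R > 0" "\<And>s. s \<in> {-r..0} \<Longrightarrow> norm (\<phi> s) < R"
    "\<And>\<tau> b x t. solves_upto r m F \<delta> \<tau> \<phi> b x \<Longrightarrow> t \<in> {\<tau> - r..b} \<Longrightarrow> norm (x t) < R"
proof -
  obtain \<kappa> \<rho> where *: "\<kappa> > 0" "\<rho> > 0"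
    "\<And>\<tau> \<phi> b x t. continuous_on {-r..0} \<phi> \<Longrightarrow> solves_upto r m F \<delta> \<tau> \<phi> b x \<Longrightarrow> \<tau> \<le> t \<Longrightarrow> t \<le> b
       \<Longrightarrow> norm (x t) \<le> 2 * hist_norm r \<phi> * exp (- \<kappa> * (t - \<tau>)) + \<rho>"
    by (rule decay_estimate) blast
  have "norm (\<phi> 0) \<le> hist_norm r \<phi>" by (rule norm_le_hist_norm[OF assms]) (use r_nonneg in auto)
  then have H: "hist_norm r \<phi> \<ge> 0" using norm_ge_zero order_trans by blast
  define R where "R = 2 * hist_norm r \<phi> + \<rho> + 1"
  have \<phi>: "norm (\<phi> s) < R" if "s \<in> {-r..0}" for s
    using norm_le_hist_norm[OF assms that] H * by (simp add: R_def)
  show ?thesis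
  proof
    show "R > 0" using H * by (simp add: R_def)
    show "norm (\<phi> s) < R" if "s \<in> {-r..0}" for s by (rule \<phi>[OF that])
    fix \<tau> b x t assume sol: "solves_upto r m F \<delta> \<tau> \<phi> b x" and t: "t \<in> {\<tau> - r..b}"
    show "norm (x t) < R"
    proof (cases "t \<le> \<tau>")
      case True
      then have "t - \<tau> \<in> {-r..0}" using t by auto
      then show ?thesis using sol \<phi>[of "t - \<tau>"] unfolding solves_upto_def
        by (metis add.commute diff_add_cancel)
    next
      case False
      then have "norm (x t) \<le> 2 * hist_norm r \<phi> * exp (- \<kappa> * (t - \<tau>)) + \<rho>"
        using *(3)[OF assms sol] t by simp
      also have "\<dots> \<le> 2 * hist_norm r \<phi> * 1 + \<rho>"
        using H * False by (intro add_mono mult_left_mono) auto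
      finally show ?thesis by (simp add: R_def)
    qed
  qed
qed

text \<open>Both solutions stay inside the ball of radius \<open>R\<close>, so they also solve the
  truncated system, where uniqueness is known.\<close>

lemma solution_unique:
  assumes "solves_upto r m F \<delta> \<tau> \<phi> b x" "solves_upto r m F \<delta> \<tau> \<phi> b y"
    and \<phi>: "continuous_on {-r..0} \<phi>" and "\<tau> \<le> b" "t \<in> {\<tau> - r..b}"
  shows "x t = y t"
proof -
  obtain R where R: "R > 0"
    "\<And>\<tau> b x t. solves_upto r m F \<delta> \<tau> \<phi> b x \<Longrightarrow> t \<in> {\<tau> - r..b} \<Longrightarrow> norm (x t) < R"
    using solution_bound[OF \<phi>] by metis
  obtain B L where "lipschitz_delay_system r \<tau> b B L m (truncated R) \<delta> \<phi>"
    using truncated_lipschitz_system[OF R(1) \<open>\<tau> \<le> b\<close> \<phi>] by blast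
  then interpret lipschitz_delay_system r \<tau> b B L m "truncated R" \<delta> \<phi> .
  have "solves_upto r m (truncated R) \<delta> \<tau> \<phi> b z" if "solves_upto r m F \<delta> \<tau> \<phi> b z" for z
    by (rule solves_upto_cong[OF that _ \<delta>_range _ r_nonneg \<open>\<tau> \<le> b\<close>])
      (use R(2)[OF that] in \<open>auto simp: truncated_eq less_imp_le\<close>)
  then show ?thesis using solution_unique assms by blast
qed

text \<open>A solution of the truncated system solves the original one up to the first time its norm
  equals \<open>R\<close>; the strict a priori bound at that very time rules such a time
  out.\<close>

lemma ex_solution:
  assumes \<phi>: "continuous_on {-r..0} \<phi>" and "\<tau> \<le> b"
  shows "\<exists>x. solves_upto r m F \<delta> \<tau> \<phi> b x"
proof -
  obtain R where R: "R > 0" "\<And>s. s \<in> {-r..0} \<Longrightarrow> norm (\<phi> s) < R"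
    "\<And>\<tau> b x t. solves_upto r m F \<delta> \<tau> \<phi> b x \<Longrightarrow> t \<in> {\<tau> - r..b} \<Longrightarrow> norm (x t) < R"
    using solution_bound[OF \<phi>] by metis
  obtain B L where "lipschitz_delay_system r \<tau> b B L m (truncated R) \<delta> \<phi>"
    using truncated_lipschitz_system[OF R(1) \<open>\<tau> \<le> b\<close> \<phi>] by blast
  then interpret lipschitz_delay_system r \<tau> b B L m "truncated R" \<delta> \<phi> .
  obtain y where y: "solves_upto r m (truncated R) \<delta> \<tau> \<phi> b y" using ex_solution by blast
  have untruncate: "solves_upto r m F \<delta> \<tau> \<phi> c y"
    if "\<tau> \<le> c" "c \<le> b" and le: "\<And>u. \<tau> - r \<le> u \<Longrightarrow> u \<le> c \<Longrightarrow> norm (y u) \<le> R" for c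
    by (rule solves_upto_cong[OF solves_upto_restrict[OF y \<open>c \<le> b\<close>] _ \<delta>_range _ r_nonneg \<open>\<tau> \<le> c\<close>])
      (use le in \<open>auto simp: truncated_eq\<close>)
  have hist: "norm (y u) < R" if "\<tau> - r \<le> u" "u \<le> \<tau>" for u
  proof -
    have "u - \<tau> \<in> {-r..0}" using that by auto
    then show ?thesis using y R(2)[of "u - \<tau>"] unfolding solves_upto_def
      by (metis add.commute diff_add_cancel)
  qed
  have "norm (y t) < R" if "\<tau> \<le> t" "t \<le> b" for t
  proof (rule ccontr)
    assume "\<not> norm (y t) < R"
    then have "R \<le> norm (y t)" by simp
    have "continuous_on {\<tau>..t} (\<lambda>t. norm (y t))"
      using y that r_nonneg unfolding solves_upto_def
      by (intro continuous_on_norm) (auto elim: continuous_on_subset)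
    from first_time_eq[OF that(1) this _ \<open>R \<le> norm (y t)\<close>] obtain u
      where u: "\<tau> < u" "u \<le> t" "norm (y u) = R" "\<And>s. \<tau> \<le> s \<Longrightarrow> s < u \<Longrightarrow> norm (y s) < R"
      using hist[of \<tau>] r_nonneg by (metis diff_le_eq le_add_same_cancel1 order_refl)
    have "norm (y s) \<le> R" if "\<tau> - r \<le> s" "s \<le> u" for s
      using hist[of s] u(3) u(4)[of s] that by (cases "s \<le> \<tau>"; cases "s = u") (auto intro: less_imp_le)
    then have "solves_upto r m F \<delta> \<tau> \<phi> u y"
      by (intro untruncate) (use u that in auto)
    then show False using R(3)[of \<tau> u y u] u r_nonneg by simp
  qed
  then have "norm (y t) \<le> R" if "\<tau> - r \<le> t" "t \<le> b" for t
    using hist[of t] that by (cases "t \<le> \<tau>") (auto intro: less_imp_le)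
  then show ?thesis using untruncate[of b] \<open>\<tau> \<le> b\<close> by blast
qed

lemma ex_global_solution:
  assumes \<phi>: "continuous_on {-r..0} \<phi>"
  obtains x where "\<And>b. \<tau> \<le> b \<Longrightarrow> solves_upto r m F \<delta> \<tau> \<phi> b x"
proof -
  obtain y where y: "\<And>b. \<tau> \<le> b \<Longrightarrow> solves_upto r m F \<delta> \<tau> \<phi> b (y b)"
    using ex_solution[OF \<phi>] by metis
  \<comment> \<open>The value at \<open>t\<close> is taken from the solution ending at
    \<open>max \<tau> t\<close>; uniqueness makes it agree with every longer one.\<close>
  have "solves_upto r m F \<delta> \<tau> \<phi> b (\<lambda>t. y (max \<tau> t) t)" if "\<tau> \<le> b" for b
  proof (rule solves_upto_cong[OF y[OF that] _ \<delta>_range _ r_nonneg that])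
    fix u assume "\<tau> - r \<le> u" "u \<le> b"
    then show "y b u = y (max \<tau> u) u"
      using solves_upto_restrict[OF y[OF that], of "max \<tau> u"] that
      by (intro solution_unique[OF _ y \<phi>, of "max \<tau> u"]) auto
  qed auto
  then show ?thesis by (rule that)
qed

text \<open>By uniqueness a solution up to \<open>T\<close> agrees with the global one, which
  therefore prolongs it to \<infinity>; maximality then forces
  \<open>T = \<infinity>\<close>.\<close>

lemma maximal_delay_solution_iff:
  assumes \<phi>: "continuous_on {-r..0} \<phi>"
  shows "maximal_delay_solution r m F \<delta> \<tau> \<phi> T x \<longleftrightarrow>
    T = \<infinity> \<and> (\<forall>b\<ge>\<tau>. solves_upto r m F \<delta> \<tau> \<phi> b x)"
proof
  assume "T = \<infinity> \<and> (\<forall>b\<ge>\<tau>. solves_upto r m F \<delta> \<tau> \<phi> b x)"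
  then show "maximal_delay_solution r m F \<delta> \<tau> \<phi> T x"
    by (simp add: maximal_delay_solution_def delay_solution_iff_solves_upto[OF r_nonneg])
next
  assume max: "maximal_delay_solution r m F \<delta> \<tau> \<phi> T x"
  then have \<tau>: "ereal \<tau> < T" and x: "\<And>b. \<tau> \<le> b \<Longrightarrow> ereal b < T \<Longrightarrow> solves_upto r m F \<delta> \<tau> \<phi> b x"
    by (auto simp: maximal_delay_solution_def delay_solution_iff_solves_upto[OF r_nonneg])
  obtain y where y: "\<And>b. \<tau> \<le> b \<Longrightarrow> solves_upto r m F \<delta> \<tau> \<phi> b y"
    using ex_global_solution[OF \<phi>] by blast
  have "y t = x t" if "\<tau> - r \<le> t" "ereal t < T" for t
    using that \<tau> by (intro solution_unique[OF y x \<phi>, of "max \<tau> t"]) (auto simp: max_def)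
  moreover have "delay_solution r m F \<delta> \<tau> \<phi> \<infinity> y"
    by (simp add: delay_solution_iff_solves_upto[OF r_nonneg] y)
  ultimately have "T = \<infinity>"
    using max unfolding maximal_delay_solution_def by (metis ereal_less_eq(1))
  then show "T = \<infinity> \<and> (\<forall>b\<ge>\<tau>. solves_upto r m F \<delta> \<tau> \<phi> b x)" using x by simp
qed

end

section \<open>Global existence and the uniform exponential bound\<close>

theorem lemma3p7:
  fixes r p q M N :: real
    and m :: nat
    and F :: "nat \<Rightarrow> real \<Rightarrow> real ^ 'n \<Rightarrow> real ^ 'n"
    and \<delta> \<beta> :: "nat \<Rightarrow> real \<Rightarrow> real"
    and \<alpha> :: "nat \<Rightarrow> real"
  assumes "r \<ge> 0"
    and "\<And>i. i \<le> m \<Longrightarrow> continuous_on UNIV (\<lambda>(t, x). F i t x)"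
    and "\<And>i. i \<le> m \<Longrightarrow> loc_lipschitz_in_space (F i)"
    and "\<And>i. i \<in> {1..m} \<Longrightarrow> \<delta> i \<in> borel_measurable lebesgue"
    and "\<And>i t. i \<in> {1..m} \<Longrightarrow> \<delta> i t \<in> {0..r}"
    and "p > q" and "q \<ge> 1"
    and "\<And>i. i \<le> m \<Longrightarrow> \<alpha> i > 0"
    and "\<And>i. i \<le> m \<Longrightarrow> \<beta> i \<in> borel_measurable lebesgue"
    and "\<And>i t. i \<le> m \<Longrightarrow> \<beta> i t \<ge> 0"
    and "\<And>t x. F 0 t x \<bullet> x \<le> - \<alpha> 0 * norm x powr (p + 1) + \<beta> 0 t"
    and "\<And>i t x. i \<in> {1..m} \<Longrightarrow> norm (F i t x) \<le> \<alpha> i * norm x powr q + \<beta> i t"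
    and "M > 0" and "N > 0"
    and "\<And>s t. s < t \<Longrightarrow>
           (\<Sum>i\<le>m. \<integral>\<^sup>+\<mu>\<in>{s..t}. ennreal (\<beta> i \<mu>) \<partial>lebesgue) \<le> ennreal (M * (t - s) + N)"
  shows "(\<forall>\<tau> \<phi>. continuous_on {-r..0} \<phi> \<longrightarrow>
            (\<exists>T x. maximal_delay_solution r m F \<delta> \<tau> \<phi> T x) \<and>
            (\<forall>T x. maximal_delay_solution r m F \<delta> \<tau> \<phi> T x \<longrightarrow> T = \<infinity>)) \<and>
         (\<exists>C>0. \<exists>\<kappa>>0. \<exists>\<rho>>0. \<forall>\<tau> \<phi> T x.
            continuous_on {-r..0} \<phi> \<and> maximal_delay_solution r m F \<delta> \<tau> \<phi> T x \<longrightarrow>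
            (\<forall>t\<ge>\<tau>. norm (x t) \<le> C * hist_norm r \<phi> * exp (- \<kappa> * (t - \<tau>)) + \<rho>))"
proof -
  interpret dissipative_delay_system r p q M N m F \<delta> \<beta> \<alpha>
    by unfold_locales (fact assms)+
  obtain \<kappa> \<rho> where *: "\<kappa> > 0" "\<rho> > 0"
    "\<And>\<tau> \<phi> b x t. continuous_on {-r..0} \<phi> \<Longrightarrow> solves_upto r m F \<delta> \<tau> \<phi> b x \<Longrightarrow> \<tau> \<le> t \<Longrightarrow> t \<le> b
       \<Longrightarrow> norm (x t) \<le> 2 * hist_norm r \<phi> * exp (- \<kappa> * (t - \<tau>)) + \<rho>"
    by (rule decay_estimate) blast
  \<comment> \<open>Here \<open>C = 2\<close>. The constants \<kappa> and \<rho> were obtained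
    before \<tau> and \<phi>, hence are uniform, and \<open>T = \<infinity>\<close> makes the
    compact estimate available at every \<open>t \<ge> \<tau>\<close>.\<close>
  have "\<forall>\<tau> \<phi> T x. continuous_on {-r..0} \<phi> \<and> maximal_delay_solution r m F \<delta> \<tau> \<phi> T x \<longrightarrow>
      (\<forall>t\<ge>\<tau>. norm (x t) \<le> 2 * hist_norm r \<phi> * exp (- \<kappa> * (t - \<tau>)) + \<rho>)"
    using *(3) by (blast dest: maximal_delay_solution_iff[THEN iffD1])
  moreover have "\<exists>T x. maximal_delay_solution r m F \<delta> \<tau> \<phi> T x" if "continuous_on {-r..0} \<phi>" for \<tau> \<phi>
    using ex_global_solution[OF that] maximal_delay_solution_iff[OF that] by metis
  ultimately show ?thesis
    using *(1,2) maximal_delay_solution_iff zero_less_numeral by metis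
qed

end
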